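(* Let $X_1,X_2$ be independent and uniformly distributed on $[0,1)$, with $X_i$ known only at node $i$ ($i=1,2$), and let $f(X_1,X_2)=1$ if $X_1-X_2\ge0$ and $f(X_1,X_2)=0$ if $X_1-X_2<0$. Then the sum rate of every zero-error interactive protocol for computing $f$ is no smaller than $4$ bits.
   Context: This is the two-node case with one positive and one negative weight and threshold $0$. A (deterministic) interactive protocol between the two nodes is a binary tree, possibly infinite, in which each internal vertex is owned by node 1 or node 2 and is labelled by a Borel function from $[0,1)$ to $\{0,1\}$ applied to the owner's value $X_i$; the resulting bit is transmitted to the other node and determines which child is visited next. Starting from the root, the protocol terminates (with probability one) when a leaf is reached. Thus the set of inputs reaching a given leaf is a combinatorial rectangle (a Cartesian product of two subsets of $[0,1)$). The protocol is zero-error if $f$ is constant on the set of inputs reaching each leaf, so that both nodes know $f(X_1,X_2)$ when the protocol terminates. The sum rate is the expected total number of bits transmitted by both nodes, the expectation being over $(X_1,X_2)$. *)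

theory Defs
  imports "HOL-Probability.Probability"
begin

datatype node = Node1 | Node2

text \<open>The pair \<open>(X\<^sub>1, X\<^sub>2)\<close> is the joint input; \<open>input i\<close> is the part of it known at node \<open>i\<close>.\<close>

primrec input :: "node \<Rightarrow> real \<times> real \<Rightarrow> real" where
  "input Node1 x = fst x"
| "input Node2 x = snd x"

definition inputs :: "(real \<times> real) set" where
  "inputs = {0..<1} \<times> {0..<1}"

datatype label = Leaf | Internal node "real \<Rightarrow> bool"

text \<open>A position in the binary tree is addressed by the list of bits leading to it from the root
  (the bits transmitted so far, oldest first; \<open>False\<close> is 0 and \<open>True\<close> is 1). A protocol labels
  all positions, but only those in \<open>vertices\<close>, having no leaf strictly above them, belong to the
  tree; labels elsewhere are irrelevant. The tree may be infinite.\<close>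

type_synonym protocol = "bool list \<Rightarrow> label"

definition vertices :: "protocol \<Rightarrow> bool list set" where
  "vertices P = {v. \<forall>k<length v. P (take k v) \<noteq> Leaf}"

definition leaves :: "protocol \<Rightarrow> bool list set" where
  "leaves P = {v \<in> vertices P. P v = Leaf}"

definition borel_protocol :: "protocol \<Rightarrow> bool" where
  "borel_protocol P \<longleftrightarrow>
    (\<forall>v \<in> vertices P. \<forall>i \<phi>. P v = Internal i \<phi> \<longrightarrow>
      \<phi> \<in> measurable (restrict_space borel {0..<1}) (count_space UNIV))"

definition reaching :: "protocol \<Rightarrow> bool list \<Rightarrow> (real \<times> real) set" where
  "reaching P v = {x \<in> inputs. \<forall>k<length v.
     \<exists>i \<phi>. P (take k v) = Internal i \<phi> \<and> v ! k = \<phi> (input i x)}"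

definition terminates_on :: "protocol \<Rightarrow> real \<times> real \<Rightarrow> bool" where
  "terminates_on P x \<longleftrightarrow> (\<exists>v \<in> leaves P. x \<in> reaching P v)"

definition zero_error :: "(real \<times> real \<Rightarrow> 'c) \<Rightarrow> protocol \<Rightarrow> bool" where
  "zero_error f P \<longleftrightarrow> (\<forall>v \<in> leaves P. f constant_on reaching P v)"

text \<open>For \<open>x \<in> inputs\<close>, the supremum over all visited vertices is the depth of the leaf reached, and \<open>\<infinity>\<close> if the
  protocol runs forever on \<open>x\<close>.\<close>

definition num_bits :: "protocol \<Rightarrow> real \<times> real \<Rightarrow> ennreal" where
  "num_bits P x = (SUP v \<in> {v \<in> vertices P. x \<in> reaching P v}. of_nat (length v))"

definition sum_rate :: "'a measure \<Rightarrow> ('a \<Rightarrow> real) \<Rightarrow> ('a \<Rightarrow> real) \<Rightarrow> protocol \<Rightarrow> ennreal" where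
  "sum_rate M X1 X2 P = (\<integral>\<^sup>+\<omega>. num_bits P (X1 \<omega>, X2 \<omega>) \<partial>M)"

definition threshold :: "real \<times> real \<Rightarrow> nat" where
  "threshold x = (if fst x - snd x \<ge> 0 then 1 else 0)"

end

theory Submission
  imports Defs "HOL-Real_Asymp.Real_Asymp"
begin

text \<open>Write \<open>p\<close> for the probability of the rectangle \<open>R = A \<times> B\<close> of a leaf \<open>v\<close>. On \<open>R\<close> the two inputs are
  separated by a point \<open>t\<close>, so \<open>\<integral>\<^sub>R - ln \<bar>x - y\<bar>\<close> only grows when \<open>A\<close> and \<open>B\<close> are pushed against \<open>t\<close> to
  intervals of the same lengths; it can then be evaluated, and \<open>h\<^sub>2(s) \<ge> 4 s (1 - s)\<close> for the binary entropy
  \<open>h\<^sub>2\<close> gives \<open>\<integral>\<^sub>R - 2 ln \<bar>x - y\<bar> \<le> p (3 - 4 ln 2 - ln p)\<close>, with equality for the squares of the dyadic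
  protocol. Gibbs' inequality \<open>- p ln p \<le> p \<bar>v\<bar> ln 2 + 2 ^ - \<bar>v\<bar> - p\<close>, summed over all leaves
  with Kraft's inequality, turns this into \<open>3 = \<integral> - 2 ln \<bar>x - y\<bar> \<le> 3 - 4 ln 2 + E ln 2\<close> for the sum
  rate \<open>E\<close>. The constant \<open>4 ln 2 - 2\<close> below is added to the integrand to keep both sides
  nonnegative, so that everything can be done in \<open>ennreal\<close>.\<close>

section \<open>Integrals of the logarithm over intervals and adjacent rectangles\<close>

lemma continuous_on_x_ln_x: "continuous_on {0..} (\<lambda>s::real. s * ln s)"
proof -
  have "continuous (at s within {0..}) (\<lambda>s. s * ln s)" if "0 \<le> s" for s :: real
  proof (cases "s = 0")
    case True
    have "((\<lambda>s::real. s * ln s) \<longlongrightarrow> 0) (at_right 0)" by real_asymp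
    moreover have "at 0 within {0..} = (at_right 0 :: real filter)"
      by (rule at_within_nhd[of _ UNIV]) auto
    ultimately show ?thesis using True by (simp add: continuous_within)
  next
    case False
    then show ?thesis using that by (intro continuous_intros) auto
  qed
  then show ?thesis by (simp add: continuous_on_eq_continuous_within)
qed

text \<open>Iterated antiderivatives of \<open>\<lambda>s. - ln s\<close>. Since \<open>0 * ln 0 = 0\<close>, they are continuous at \<open>0\<close>.\<close>

definition neg_ln_int :: "real \<Rightarrow> real" where
  "neg_ln_int s = s - s * ln s"

definition neg_ln_int2 :: "real \<Rightarrow> real" where
  "neg_ln_int2 s = 3 / 4 * s^2 - s / 2 * (s * ln s)"

lemma neg_ln_int_0 [simp]: "neg_ln_int 0 = 0" and neg_ln_int2_0 [simp]: "neg_ln_int2 0 = 0"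
  by (simp_all add: neg_ln_int_def neg_ln_int2_def)

lemma continuous_on_neg_ln_int: "continuous_on {0..} neg_ln_int"
  unfolding neg_ln_int_def by (intro continuous_intros continuous_on_x_ln_x)

lemma continuous_on_neg_ln_int2: "continuous_on {0..} neg_ln_int2"
  unfolding neg_ln_int2_def by (intro continuous_intros continuous_on_x_ln_x) auto

lemma neg_ln_int_deriv: "0 < s \<Longrightarrow> (neg_ln_int has_real_derivative - ln s) (at s)"
  unfolding neg_ln_int_def by (auto intro!: derivative_eq_intros)

lemma neg_ln_int2_deriv: "0 < s \<Longrightarrow> (neg_ln_int2 has_real_derivative neg_ln_int s) (at s)"
  unfolding neg_ln_int2_def neg_ln_int_def
  by (auto intro!: derivative_eq_intros simp: field_simps power2_eq_square)

lemma neg_ln_int_mono: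
  assumes "0 \<le> s" "s \<le> t" "t \<le> 1"
  shows "neg_ln_int s \<le> neg_ln_int t"
proof (cases "s = t")
  case False
  then have "s < t" using assms by simp
  have "continuous_on {s..t} neg_ln_int"
    using assms by (intro continuous_on_subset[OF continuous_on_neg_ln_int]) auto
  then show ?thesis
  proof (rule DERIV_nonneg_imp_increasing_open[OF assms(2), rotated])
    fix x assume "s < x" "x < t"
    then show "\<exists>y. (neg_ln_int has_real_derivative y) (at x) \<and> 0 \<le> y"
      using assms by (intro exI[of _ "- ln x"] conjI neg_ln_int_deriv) auto
  qed
qed simp

text \<open>The value \<open>\<infinity>\<close> on the nonpositive numbers makes this function antitone.\<close>

definition neg_ln :: "real \<Rightarrow> ennreal" where
  "neg_ln s = (if s \<le> 0 then \<infinity> else ennreal (- ln s))"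

lemma neg_ln_measurable [measurable]: "neg_ln \<in> borel_measurable borel"
  unfolding neg_ln_def by measurable

lemma antimono_neg_ln: "antimono neg_ln"
  by (rule antimonoI) (auto simp: neg_ln_def intro!: ennreal_leI)

lemma nn_integral_neg_ln:
  assumes "0 \<le> w" "0 \<le> b" "w + b \<le> 1"
  shows "(\<integral>\<^sup>+u. neg_ln (w + u) * indicator {0..b} u \<partial>lborel) = ennreal (neg_ln_int (w + b) - neg_ln_int w)"
proof -
  have "((\<lambda>u. - ln (w + u)) has_integral (neg_ln_int (w + b) - neg_ln_int (w + 0))) {0..b}"
  proof (rule fundamental_theorem_of_calculus_interior[OF assms(2)])
    show "continuous_on {0..b} (\<lambda>u. neg_ln_int (w + u))"
      using assms
      by (intro continuous_on_compose2[OF continuous_on_neg_ln_int] continuous_intros) auto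
    show "((\<lambda>u. neg_ln_int (w + u)) has_vector_derivative - ln (w + u)) (at u)"
      if "u \<in> {0<..<b}" for u
      using that assms neg_ln_int_deriv[of "u + w"]
      unfolding has_real_derivative_iff_has_vector_derivative[symmetric] DERIV_shift
      by (simp add: add.commute)
  qed
  then have "(\<integral>\<^sup>+u. ennreal (- ln (w + u)) * indicator {0..b} u \<partial>lborel)
      = ennreal (neg_ln_int (w + b) - neg_ln_int (w + 0))"
    by (intro nn_integral_has_integral_lebesgue') (use assms in \<open>auto simp: ln_le_zero_iff ln_eq_zero_iff le_less\<close>)
  moreover have "(\<integral>\<^sup>+u. neg_ln (w + u) * indicator {0..b} u \<partial>lborel)
      = (\<integral>\<^sup>+u. ennreal (- ln (w + u)) * indicator {0..b} u \<partial>lborel)"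
  \<comment> \<open>For \<open>w = 0\<close> the integrands differ at \<open>u = 0\<close>, where
    \<open>neg_ln\<close> is infinite but \<open>ln 0 = 0\<close>.\<close>
  proof (rule nn_integral_cong_AE)
    show "AE u in lborel. neg_ln (w + u) * indicator {0..b} u
        = ennreal (- ln (w + u)) * indicator {0..b} u"
      using AE_lborel_singleton[of 0]
      by eventually_elim (use assms in \<open>auto simp: neg_ln_def indicator_def\<close>)
  qed
  ultimately show ?thesis by simp
qed

text \<open>This evaluates the extremal configuration: intervals of lengths \<open>a\<close> and
  \<open>b\<close> touching a common point from opposite sides, where points at distances
  \<open>u\<close> and \<open>v\<close> from it are \<open>u + v\<close> apart.\<close>

lemma nn_integral_neg_ln_rectangle:
  assumes "0 \<le> a" "0 \<le> b" "a + b \<le> 1"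
  shows "(\<integral>\<^sup>+u. (\<integral>\<^sup>+v. neg_ln (u + v) * indicator {0..b} v \<partial>lborel) * indicator {0..a} u \<partial>lborel)
    = ennreal (neg_ln_int2 (a + b) - neg_ln_int2 a - neg_ln_int2 b)"
proof -
  have "((\<lambda>u. neg_ln_int (u + b) - neg_ln_int u) has_integral
      ((neg_ln_int2 (a + b) - neg_ln_int2 a) - (neg_ln_int2 (0 + b) - neg_ln_int2 0))) {0..a}"
  proof (rule fundamental_theorem_of_calculus_interior[OF assms(1)])
    show "continuous_on {0..a} (\<lambda>u. neg_ln_int2 (u + b) - neg_ln_int2 u)"
      using assms
      by (intro continuous_on_compose2[OF continuous_on_neg_ln_int2] continuous_intros) auto
    show "((\<lambda>u. neg_ln_int2 (u + b) - neg_ln_int2 u) has_vector_derivative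
        neg_ln_int (u + b) - neg_ln_int u) (at u)" if "u \<in> {0<..<a}" for u
      using that assms unfolding has_real_derivative_iff_has_vector_derivative[symmetric]
      by (auto intro!: derivative_eq_intros DERIV_chain2[OF neg_ln_int2_deriv] neg_ln_int2_deriv)
  qed
  then have "(\<integral>\<^sup>+u. ennreal (neg_ln_int (u + b) - neg_ln_int u) * indicator {0..a} u \<partial>lborel)
      = ennreal (neg_ln_int2 (a + b) - neg_ln_int2 a - neg_ln_int2 (0 + b) + neg_ln_int2 0)"
    by (subst nn_integral_has_integral_lebesgue')
      (use assms in \<open>auto intro!: neg_ln_int_mono simp: algebra_simps\<close>)
  moreover have "(\<integral>\<^sup>+u. (\<integral>\<^sup>+v. neg_ln (u + v) * indicator {0..b} v \<partial>lborel) * indicator {0..a} u \<partial>lborel)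
      = (\<integral>\<^sup>+u. ennreal (neg_ln_int (u + b) - neg_ln_int u) * indicator {0..a} u \<partial>lborel)"
    by (intro nn_integral_cong) (use assms in \<open>auto simp: nn_integral_neg_ln split: split_indicator\<close>)
  ultimately show ?thesis by simp
qed

section \<open>Rearrangement: pushing sets against a separating point\<close>

text \<open>Bathtub principle: going from \<open>A\<close> to \<open>{0..c}\<close> trades points
  where \<open>\<psi>\<close> is at most \<open>\<psi> c\<close> for equally much mass where it is
  at least \<open>\<psi> c\<close>.\<close>

lemma nn_integral_antimono_le_initial_segment:
  fixes \<psi> :: "real \<Rightarrow> ennreal"
  assumes \<psi>: "antimono \<psi>" and [measurable]: "\<psi> \<in> borel_measurable borel" "A \<in> sets borel"
    and A: "A \<subseteq> {0..}" "emeasure lborel A = ennreal c" and c: "0 \<le> c"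
  shows "(\<integral>\<^sup>+u. \<psi> u * indicator A u \<partial>lborel) \<le> (\<integral>\<^sup>+u. \<psi> u * indicator {0..c} u \<partial>lborel)"
proof (cases "\<psi> c = \<infinity>")
  case True
  show ?thesis
  proof (cases "c = 0")
    case True
    then have "A \<in> null_sets lborel" using A by (intro null_setsI) auto
    then have "(\<integral>\<^sup>+u. \<psi> u * indicator A u \<partial>lborel) = 0"
      by (rule nn_integral_null_set)
    then show ?thesis by simp
  next
    case False
    have "\<psi> u = \<infinity>" if "u \<le> c" for u
      using antimonoD[OF \<psi> that] True by (simp add: top_unique)
    then have "(\<integral>\<^sup>+u. \<psi> u * indicator {0..c} u \<partial>lborel) = (\<integral>\<^sup>+u. \<infinity> * indicator {0..c} u \<partial>lborel)"
      by (intro nn_integral_cong) (auto simp: indicator_def)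
    also have "\<dots> = \<infinity>"
      using c False by (subst nn_integral_cmult_indicator) (auto simp: ennreal_top_mult)
    finally show ?thesis by simp
  qed
next
  case False
  \<comment> \<open>Since \<open>ennreal\<close> has no useful subtraction here, the inequality
    \<open>(\<psi> u - \<psi> c) * (indicator {0..c} u - indicator A u) >= 0\<close> is used with
    its negative terms moved across; the added \<open>\<psi> c * ennreal c\<close> is finite and
    cancels at the end.\<close>
  have "(\<integral>\<^sup>+u. \<psi> u * indicator A u \<partial>lborel) + \<psi> c * ennreal c
      = (\<integral>\<^sup>+u. \<psi> u * indicator A u + \<psi> c * indicator {0..c} u \<partial>lborel)"
    using c by (subst nn_integral_add) (auto simp: nn_integral_cmult_indicator)
  also have "\<dots> \<le> (\<integral>\<^sup>+u. \<psi> u * indicator {0..c} u + \<psi> c * indicator A u \<partial>lborel)"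
    using A(1) antimonoD[OF \<psi>]
    by (intro nn_integral_mono) (auto simp: indicator_def add.commute)
  also have "\<dots> = (\<integral>\<^sup>+u. \<psi> u * indicator {0..c} u \<partial>lborel) + \<psi> c * ennreal c"
    using A by (subst nn_integral_add) (auto simp: nn_integral_cmult_indicator)
  finally show ?thesis
    using False by (simp add: add.commute[of _ "\<psi> c * ennreal c"] ennreal_add_left_cancel_le
        ennreal_mult_eq_top_iff)
qed

text \<open>The sign \<open>s\<close> lets the principle apply on either side of \<open>t\<close>:
  the map from \<open>x\<close> to \<open>s * (x - t)\<close> is a translation or a reflection,
  preserves length and carries \<open>A\<close> into the nonnegative half-line.\<close>

lemma nn_integral_antimono_le_affine:
  fixes \<psi> :: "real \<Rightarrow> ennreal"
  assumes \<psi>: "antimono \<psi>" and [measurable]: "\<psi> \<in> borel_measurable borel" "A \<in> sets borel"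
    and A: "\<And>x. x \<in> A \<Longrightarrow> 0 \<le> s * (x - t)" "emeasure lborel A = ennreal c" and c: "0 \<le> c"
    and s: "s = 1 \<or> s = - 1"
  shows "(\<integral>\<^sup>+x. \<psi> (s * (x - t)) * indicator A x \<partial>lborel) \<le> (\<integral>\<^sup>+u. \<psi> u * indicator {0..c} u \<partial>lborel)"
proof -
  define A' where "A' = (\<lambda>u. t + s * u) -` A"
  have A'[measurable]: "A' \<in> sets borel"
    using measurable_sets[of "\<lambda>u. t + s * u" borel borel A] by (simp add: A'_def)
  have ss: "s * s = 1" "\<bar>s\<bar> = 1" "s \<noteq> 0" using s by auto
  have subst: "(\<integral>\<^sup>+x. f x \<partial>lborel) = (\<integral>\<^sup>+u. f (t + s * u) \<partial>lborel)"
    if "f \<in> borel_measurable borel" for f :: "real \<Rightarrow> ennreal"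
    using nn_integral_real_affine[OF that ss(3), of t] ss by simp
  have ind: "indicator A (t + s * u) = (indicator A' u :: ennreal)" for u
    by (auto simp: A'_def indicator_def)
  have "emeasure lborel A' = emeasure lborel A"
    using subst[of "indicator A"] by (simp add: ind)
  moreover have "A' \<subseteq> {0..}"
  proof
    fix u assume "u \<in> A'"
    then have "0 \<le> s * ((t + s * u) - t)" by (intro A(1)) (simp add: A'_def)
    also have "\<dots> = u" using ss(1) by (simp add: mult.assoc[symmetric])
    finally show "u \<in> {0..}" by simp
  qed
  moreover have "(\<integral>\<^sup>+x. \<psi> (s * (x - t)) * indicator A x \<partial>lborel) = (\<integral>\<^sup>+u. \<psi> u * indicator A' u \<partial>lborel)"
    using ss(1) by (subst subst) (auto simp: ind mult.assoc[symmetric])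
  ultimately show ?thesis
    using nn_integral_antimono_le_initial_segment[OF \<psi> _ A', of c] A(2) c by simp
qed

text \<open>The principle is used twice. For fixed \<open>x\<close> it pushes \<open>B\<close> up to
  \<open>t\<close>; the resulting bound \<open>\<Psi> (x - t)\<close> is again antitone in the
  distance to \<open>t\<close>, so it then pushes \<open>A\<close> down to \<open>t\<close>.\<close>

lemma nn_integral_neg_ln_separated:
  assumes [measurable]: "A \<in> sets borel" "B \<in> sets borel"
    and A: "A \<subseteq> {t..1}" "emeasure lborel A = ennreal a" "0 \<le> a"
    and B: "B \<subseteq> {0..t}" "emeasure lborel B = ennreal b" "0 \<le> b"
    and t: "0 \<le> t" "t \<le> 1"
  shows "(\<integral>\<^sup>+x. (\<integral>\<^sup>+y. neg_ln \<bar>x - y\<bar> * indicator B y \<partial>lborel) * indicator A x \<partial>lborel)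
    \<le> ennreal (neg_ln_int2 (a + b) - neg_ln_int2 a - neg_ln_int2 b)"
proof -
  define \<Psi> where "\<Psi> u = (\<integral>\<^sup>+v. neg_ln (u + v) * indicator {0..b} v \<partial>lborel)" for u
  have [measurable]: "\<Psi> \<in> borel_measurable borel" unfolding \<Psi>_def by measurable
  have \<Psi>: "antimono \<Psi>" unfolding \<Psi>_def
    by (rule antimonoI)
      (auto intro!: nn_integral_mono mult_right_mono antimonoD[OF antimono_neg_ln])
  have "ennreal a \<le> ennreal (1 - t)" "ennreal b \<le> ennreal t"
    using emeasure_mono[OF A(1), of lborel] emeasure_mono[OF B(1), of lborel] A B t by auto
  then have ab: "a + b \<le> 1" using t by simp
  have "(\<integral>\<^sup>+y. neg_ln \<bar>x - y\<bar> * indicator B y \<partial>lborel) \<le> \<Psi> (x - t)" if "x \<in> A" for x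
  proof -
    \<comment> \<open>As \<open>y <= t <= x\<close>, the distance splits into the distances of
      \<open>x\<close> and \<open>y\<close> from \<open>t\<close>.\<close>
    have "(\<integral>\<^sup>+y. neg_ln \<bar>x - y\<bar> * indicator B y \<partial>lborel)
        = (\<integral>\<^sup>+y. neg_ln ((x - t) + (- 1) * (y - t)) * indicator B y \<partial>lborel)"
      using A(1) B(1) that
      by (intro nn_integral_cong) (auto simp: indicator_def abs_if subset_eq intro!: arg_cong[of _ _ neg_ln], force+)
    also have "\<dots> \<le> \<Psi> (x - t)" unfolding \<Psi>_def
      by (rule nn_integral_antimono_le_affine[of "\<lambda>u. neg_ln ((x - t) + u)"])
        (use B in \<open>auto intro!: antimonoI antimonoD[OF antimono_neg_ln]\<close>)
    finally show ?thesis .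
  qed
  then have "(\<integral>\<^sup>+x. (\<integral>\<^sup>+y. neg_ln \<bar>x - y\<bar> * indicator B y \<partial>lborel) * indicator A x \<partial>lborel)
      \<le> (\<integral>\<^sup>+x. \<Psi> (1 * (x - t)) * indicator A x \<partial>lborel)"
    by (intro nn_integral_mono) (auto simp: indicator_def)
  also have "\<dots> \<le> (\<integral>\<^sup>+u. \<Psi> u * indicator {0..a} u \<partial>lborel)"
    by (rule nn_integral_antimono_le_affine[OF \<Psi>]) (use A in auto)
  also have "\<dots> = ennreal (neg_ln_int2 (a + b) - neg_ln_int2 a - neg_ln_int2 b)"
    unfolding \<Psi>_def using A B ab by (intro nn_integral_neg_ln_rectangle) auto
  finally show ?thesis .
qed

section \<open>The entropy inequality and the bound in terms of the area\<close>

text \<open>This is \<open>h\<^sub>2(s) \<ge> 4 s (1 - s)\<close>, written in terms of \<open>z = (1 - s) / s\<close>, in which the quotient of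
  the two sides is monotone.\<close>

lemma entropy_ratio_ge:
  fixes z :: real
  assumes "1 \<le> z"
  shows "4 * ln 2 \<le> (1 + 1 / z) * ln (1 + z) + (1 + z) * (ln (1 + z) - ln z)"
proof -
  let ?G = "\<lambda>z::real. (1 + 1 / z) * ln (1 + z) + (1 + z) * (ln (1 + z) - ln z)"
  \<comment> \<open>The constant is \<open>?G 1 = 4 * ln 2\<close>.\<close>
  have "?G 1 \<le> ?G z"
  proof (rule DERIV_nonneg_imp_nondecreasing[OF assms])
    fix x :: real assume x: "1 \<le> x" "x \<le> z"
    let ?l = "ln (1 + x) - ln x"
    have "(?G has_real_derivative (- (1 / x^2) * ln (1 + x) + (1 + 1 / x) * (1 / (1 + x)))
        + (?l + (1 + x) * (1 / (1 + x) - 1 / x))) (at x)"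
      using x by (auto intro!: derivative_eq_intros simp: power2_eq_square)
    moreover have "(1 + 1 / x) * (1 / (1 + x)) = 1 / x" "(1 + x) * (1 / (1 + x) - 1 / x) = - (1 / x)"
      using x add_pos_pos[of x "x * x"] by (simp_all add: field_simps)
    ultimately have "(?G has_real_derivative ?l - ln (1 + x) / x^2) (at x)"
      by simp
    \<comment> \<open>Because \<open>ln (1 + x) = ln x + ?l\<close>, the claim amounts to
      \<open>ln x <= (x^2 - 1) * ?l\<close>; the value \<open>x - 1\<close> lies between the two
      sides.\<close>
    moreover have "0 \<le> ?l - ln (1 + x) / x^2"
    proof -
      have "ln (x / (1 + x)) \<le> x / (1 + x) - 1" using x by (intro ln_le_minus_one) auto
      also have "\<dots> = - (1 / (1 + x))" using x by (simp add: field_simps)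
      finally have "1 / (1 + x) \<le> ?l" using x by (simp add: ln_div)
      then have "(x^2 - 1) * (1 / (1 + x)) \<le> (x^2 - 1) * ?l"
        using x by (intro mult_left_mono) auto
      moreover have "(x^2 - 1) * (1 / (1 + x)) = x - 1"
        using x by (simp add: field_simps power2_eq_square)
      moreover have "ln x \<le> x - 1" using x by (intro ln_le_minus_one) auto
      ultimately have "ln (1 + x) \<le> x^2 * ?l" by (simp add: algebra_simps)
      then show ?thesis using x by (simp add: field_simps)
    qed
    ultimately show "\<exists>y. (?G has_real_derivative y) (at x) \<and> 0 \<le> y" by blast
  qed
  then show ?thesis by simp
qed

text \<open>By symmetry let \<open>a <= b\<close> and scale by \<open>b = a * z\<close>. The
  quadratic terms give \<open>3 * a * b\<close>, the \<open>ln a\<close> terms cancel, and what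
  remains is \<open>a^2 * z\<close> times the entropy inequality at \<open>z\<close>.\<close>

lemma neg_ln_int2_diff_le:
  assumes "0 < a" "0 < b"
  shows "2 * (neg_ln_int2 (a + b) - neg_ln_int2 a - neg_ln_int2 b) \<le> a * b * (3 - 4 * ln 2 - ln (a * b))"
proof -
  have *: "2 * (neg_ln_int2 (a + b) - neg_ln_int2 a - neg_ln_int2 b) \<le> a * b * (3 - 4 * ln 2 - ln (a * b))"
    if "0 < a" "a \<le> b" for a b
  proof -
    define z where "z = b / a"
    have z: "1 \<le> z" "b = a * z" "a + b = a * (1 + z)"
      using that by (auto simp: z_def field_simps)
    have "z * (4 * ln 2) \<le> z * ((1 + 1 / z) * ln (1 + z) + (1 + z) * (ln (1 + z) - ln z))"
      using z(1) by (intro mult_left_mono entropy_ratio_ge) auto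
    also have "\<dots> = (1 + z)^2 * ln (1 + z) - z^2 * ln z - z * ln z"
      using z(1) by (simp add: field_simps power2_eq_square)
    finally have "a^2 * (z * (4 * ln 2)) \<le> a^2 * ((1 + z)^2 * ln (1 + z) - z^2 * ln z - z * ln z)"
      by (intro mult_left_mono) auto
    moreover have "ln b = ln a + ln z" "ln (a + b) = ln a + ln (1 + z)" "ln (a * b) = 2 * ln a + ln z"
      using z that by (simp_all add: ln_mult)
    ultimately show ?thesis
      unfolding neg_ln_int2_def using z by (simp add: field_simps power2_eq_square)
  qed
  show ?thesis
    using *[of a b] *[of b a] assms by (cases "a \<le> b") (auto simp: algebra_simps)
qed

section \<open>Integration against the uniform distribution on the unit square\<close>

abbreviation (input) unif :: "real measure" where
  "unif \<equiv> uniform_measure lborel {0..<1}"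

lemma prob_space_unif: "prob_space unif"
  by (rule prob_space_uniform_measure) auto

lemma nn_integral_unif:
  "f \<in> borel_measurable borel \<Longrightarrow> (\<integral>\<^sup>+x. f x \<partial>unif) = (\<integral>\<^sup>+x. f x * indicator {0..<1} x \<partial>lborel)"
  by (subst nn_integral_uniform_measure) (auto simp: divide_ennreal_def)

lemma nn_integral_unif_pair:
  assumes [measurable]: "f \<in> borel_measurable (borel \<Otimes>\<^sub>M borel)"
  shows "(\<integral>\<^sup>+z. f z \<partial>(unif \<Otimes>\<^sub>M unif)) =
    (\<integral>\<^sup>+x. (\<integral>\<^sup>+y. f (x, y) * indicator {0..<1} y \<partial>lborel) * indicator {0..<1} x \<partial>lborel)"
proof -
  interpret prob_space unif by (rule prob_space_unif)
  have "(\<integral>\<^sup>+z. f z \<partial>(unif \<Otimes>\<^sub>M unif)) = (\<integral>\<^sup>+x. (\<integral>\<^sup>+y. f (x, y) \<partial>unif) \<partial>unif)"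
    by (rule nn_integral_fst[symmetric]) simp
  also have "\<dots> = (\<integral>\<^sup>+x. (\<integral>\<^sup>+y. f (x, y) * indicator {0..<1} y \<partial>lborel) \<partial>unif)"
    by (intro nn_integral_cong nn_integral_unif) simp
  also have "\<dots> = (\<integral>\<^sup>+x. (\<integral>\<^sup>+y. f (x, y) * indicator {0..<1} y \<partial>lborel) * indicator {0..<1} x \<partial>lborel)"
    by (rule nn_integral_unif) simp
  finally show ?thesis .
qed

lemma nn_integral_unif_rectangle:
  assumes [measurable]: "f \<in> borel_measurable (borel \<Otimes>\<^sub>M borel)" "A \<in> sets borel" "B \<in> sets borel"
    and "A \<subseteq> {0..<1}" "B \<subseteq> {0..<1}"
  shows "(\<integral>\<^sup>+z. f z * indicator (A \<times> B) z \<partial>(unif \<Otimes>\<^sub>M unif)) =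
    (\<integral>\<^sup>+x. (\<integral>\<^sup>+y. f (x, y) * indicator B y \<partial>lborel) * indicator A x \<partial>lborel)"
  using assms(4,5)
  by (subst nn_integral_unif_pair)
    (auto intro!: nn_integral_cong simp: indicator_def subset_eq)

lemma emeasure_unif_rectangle:
  assumes [measurable]: "A \<in> sets borel" "B \<in> sets borel"
    and "A \<subseteq> {0..<1}" "B \<subseteq> {0..<1}"
  shows "emeasure (unif \<Otimes>\<^sub>M unif) (A \<times> B) = emeasure lborel A * emeasure lborel B"
proof -
  have "emeasure (unif \<Otimes>\<^sub>M unif) (A \<times> B) = (\<integral>\<^sup>+z. 1 * indicator (A \<times> B) z \<partial>(unif \<Otimes>\<^sub>M unif))"
    by simp
  also have "\<dots> = emeasure lborel A * emeasure lborel B"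
    using assms(3,4)
    by (subst nn_integral_unif_rectangle) (simp_all add: nn_integral_cmult_indicator, simp add: mult.commute)
  finally show ?thesis .
qed

lemma nn_integral_neg_ln_abs:
  assumes x: "0 \<le> x" "x < 1"
  shows "(\<integral>\<^sup>+y. neg_ln \<bar>x - y\<bar> * indicator {0..<1} y \<partial>lborel) = ennreal (neg_ln_int x + neg_ln_int (1 - x))"
proof -
  have "(\<integral>\<^sup>+y. neg_ln \<bar>x - y\<bar> * indicator {0..<1} y \<partial>lborel)
      = (\<integral>\<^sup>+u. neg_ln \<bar>u\<bar> * indicator {0..<1} (x + u) \<partial>lborel)"
    by (subst nn_integral_real_affine[where t = x and c = 1]) auto
  also have "\<dots> = (\<integral>\<^sup>+u. neg_ln u * indicator {0..1 - x} u + neg_ln (- u) * indicator {0..x} (- u) \<partial>lborel)"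
  proof (rule nn_integral_cong_AE)
    show "AE u in lborel. neg_ln \<bar>u\<bar> * indicator {0..<1} (x + u)
        = neg_ln u * indicator {0..1 - x} u + neg_ln (- u) * indicator {0..x} (- u)"
      \<comment> \<open>The two pieces share \<open>u = 0\<close>, and the first also contains the
        excluded endpoint \<open>u = 1 - x\<close>; both points are null.\<close>
      using AE_lborel_singleton[of 0] AE_lborel_singleton[of "1 - x"]
      by eventually_elim (use x in \<open>auto simp: indicator_def abs_if\<close>)
  qed
  also have "\<dots> = (\<integral>\<^sup>+u. neg_ln u * indicator {0..1 - x} u \<partial>lborel)
      + (\<integral>\<^sup>+u. neg_ln (- u) * indicator {0..x} (- u) \<partial>lborel)"
    by (rule nn_integral_add) auto
  also have "(\<integral>\<^sup>+u. neg_ln (- u) * indicator {0..x} (- u) \<partial>lborel)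
      = (\<integral>\<^sup>+u. neg_ln u * indicator {0..x} u \<partial>lborel)"
    by (subst (2) nn_integral_real_affine[where t = 0 and c = "- 1"]) auto
  finally show ?thesis
    using nn_integral_neg_ln[of 0 x] nn_integral_neg_ln[of 0 "1 - x"] x
      neg_ln_int_mono[of 0 x] neg_ln_int_mono[of 0 "1 - x"]
    by (simp add: ennreal_plus[symmetric] add.commute del: ennreal_plus)
qed

text \<open>The sections integrate to two copies of \<open>neg_ln_int2 1 = 3 / 4\<close>, one for
  each side of the diagonal.\<close>

lemma nn_integral_neg_ln_unif:
  "(\<integral>\<^sup>+z. neg_ln \<bar>fst z - snd z\<bar> \<partial>(unif \<Otimes>\<^sub>M unif)) = ennreal (3 / 2)"
proof -
  have "((\<lambda>x. neg_ln_int x + neg_ln_int (1 - x)) has_integral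
      ((neg_ln_int2 1 - neg_ln_int2 (1 - 1)) - (neg_ln_int2 0 - neg_ln_int2 (1 - 0)))) {0..1}"
  proof (rule fundamental_theorem_of_calculus_interior)
    show "continuous_on {0..1} (\<lambda>x. neg_ln_int2 x - neg_ln_int2 (1 - x))"
      by (intro continuous_on_compose2[OF continuous_on_neg_ln_int2] continuous_intros) auto
    show "((\<lambda>x. neg_ln_int2 x - neg_ln_int2 (1 - x)) has_vector_derivative
        neg_ln_int x + neg_ln_int (1 - x)) (at x)" if "x \<in> {0<..<1}" for x
      using that unfolding has_real_derivative_iff_has_vector_derivative[symmetric]
      by (auto intro!: derivative_eq_intros DERIV_chain2[OF neg_ln_int2_deriv] neg_ln_int2_deriv)
  qed simp
  then have "(\<integral>\<^sup>+x. ennreal (neg_ln_int x + neg_ln_int (1 - x)) * indicator {0..1} x \<partial>lborel) = ennreal (3 / 2)"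
    by (subst nn_integral_has_integral_lebesgue')
      (use neg_ln_int_mono[of 0] in \<open>auto simp: neg_ln_int2_def\<close>)
  moreover have "(\<integral>\<^sup>+z. neg_ln \<bar>fst z - snd z\<bar> \<partial>(unif \<Otimes>\<^sub>M unif))
      = (\<integral>\<^sup>+x. (\<integral>\<^sup>+y. neg_ln \<bar>x - y\<bar> * indicator {0..<1} y \<partial>lborel) * indicator {0..<1} x \<partial>lborel)"
    by (subst nn_integral_unif_pair) auto
  moreover have "\<dots> = (\<integral>\<^sup>+x. ennreal (neg_ln_int x + neg_ln_int (1 - x)) * indicator {0..1} x \<partial>lborel)"
  proof (rule nn_integral_cong_AE)
    show "AE x in lborel. (\<integral>\<^sup>+y. neg_ln \<bar>x - y\<bar> * indicator {0..<1} y \<partial>lborel) * indicator {0..<1} x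
        = ennreal (neg_ln_int x + neg_ln_int (1 - x)) * indicator {0..1} x"
      using AE_lborel_singleton[of 1]
      by eventually_elim (auto simp: nn_integral_neg_ln_abs split: split_indicator)
  qed
  ultimately show ?thesis by simp
qed

section \<open>The bound for one monochromatic rectangle\<close>

text \<open>When \<open>B\<close> lies below \<open>A\<close>, \<open>Sup B\<close> serves as the
  separating point. The opposite order reduces to this one by exchanging the integrals, the kernel
  being symmetric.\<close>

lemma nn_integral_neg_ln_monochromatic:
  assumes [measurable]: "A \<in> sets borel" "B \<in> sets borel"
    and A: "A \<subseteq> {0..<1}" "emeasure lborel A = ennreal a" "0 < a"
    and B: "B \<subseteq> {0..<1}" "emeasure lborel B = ennreal b" "0 < b"
    and mono: "(\<forall>x\<in>A. \<forall>y\<in>B. y \<le> x) \<or> (\<forall>x\<in>A. \<forall>y\<in>B. x \<le> y)"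
  shows "(\<integral>\<^sup>+x. (\<integral>\<^sup>+y. neg_ln \<bar>x - y\<bar> * indicator B y \<partial>lborel) * indicator A x \<partial>lborel)
    \<le> ennreal (neg_ln_int2 (a + b) - neg_ln_int2 a - neg_ln_int2 b)"
proof -
  have *: "(\<integral>\<^sup>+x. (\<integral>\<^sup>+y. neg_ln \<bar>x - y\<bar> * indicator B y \<partial>lborel) * indicator A x \<partial>lborel)
    \<le> ennreal (neg_ln_int2 (a + b) - neg_ln_int2 a - neg_ln_int2 b)"
    if [measurable]: "A \<in> sets borel" "B \<in> sets borel"
    and A: "A \<subseteq> {0..<1}" "emeasure lborel A = ennreal a" "0 < a"
    and B: "B \<subseteq> {0..<1}" "emeasure lborel B = ennreal b" "0 < b"
    and ord: "\<And>x y. x \<in> A \<Longrightarrow> y \<in> B \<Longrightarrow> y \<le> x" for A B and a b :: real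
  proof -
    have "A \<noteq> {}" "B \<noteq> {}" using A B by auto
    then obtain x0 y0 where 0: "x0 \<in> A" "y0 \<in> B" by auto
    have bdd: "bdd_above B" using B(1) by (intro bdd_aboveI[of _ 1]) force
    show ?thesis
    proof (rule nn_integral_neg_ln_separated[where t = "Sup B"])
      show "A \<subseteq> {Sup B..1}"
        using A(1) ord \<open>B \<noteq> {}\<close> by (force intro!: cSup_least)
      show "B \<subseteq> {0..Sup B}"
        using B(1) bdd by (force intro!: cSup_upper)
      show "0 \<le> Sup B" using cSup_upper[OF 0(2) bdd] B(1) 0 by force
      show "Sup B \<le> 1" using B(1) \<open>B \<noteq> {}\<close> by (force intro!: cSup_least)
    qed (use A B in auto)
  qed
  show ?thesis
    using mono
  proof
    assume "\<forall>x\<in>A. \<forall>y\<in>B. y \<le> x"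
    then show ?thesis using * A B by auto
  next
    assume ord: "\<forall>x\<in>A. \<forall>y\<in>B. x \<le> y"
    have "(\<integral>\<^sup>+x. (\<integral>\<^sup>+y. neg_ln \<bar>x - y\<bar> * indicator B y \<partial>lborel) * indicator A x \<partial>lborel)
        = (\<integral>\<^sup>+x. (\<integral>\<^sup>+y. neg_ln \<bar>x - y\<bar> * indicator B y * indicator A x \<partial>lborel) \<partial>lborel)"
      by (intro nn_integral_cong nn_integral_multc[symmetric]) auto
    also have "\<dots> = (\<integral>\<^sup>+y. (\<integral>\<^sup>+x. neg_ln \<bar>x - y\<bar> * indicator B y * indicator A x \<partial>lborel) \<partial>lborel)"
      by (rule lborel_pair.Fubini') simp
    also have "\<dots> = (\<integral>\<^sup>+y. (\<integral>\<^sup>+x. neg_ln \<bar>y - x\<bar> * indicator A x * indicator B y \<partial>lborel) \<partial>lborel)"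
      by (simp add: abs_minus_commute ac_simps)
    also have "\<dots> = (\<integral>\<^sup>+y. (\<integral>\<^sup>+x. neg_ln \<bar>y - x\<bar> * indicator A x \<partial>lborel) * indicator B y \<partial>lborel)"
      by (intro nn_integral_cong nn_integral_multc) auto
    also have "\<dots> \<le> ennreal (neg_ln_int2 (b + a) - neg_ln_int2 b - neg_ln_int2 a)"
      using * A B ord by auto
    finally show ?thesis by (simp add: algebra_simps)
  qed
qed

text \<open>Here \<open>n\<close> is arbitrary; it becomes the depth of a leaf, so that
  \<open>1 / 2 ^ n\<close> is its Kraft weight.\<close>

lemma monochromatic_rectangle_bound:
  assumes [measurable]: "A \<in> sets borel" "B \<in> sets borel"
    and A: "A \<subseteq> {0..<1}" and B: "B \<subseteq> {0..<1}"
    and mono: "(\<forall>x\<in>A. \<forall>y\<in>B. y \<le> x) \<or> (\<forall>x\<in>A. \<forall>y\<in>B. x \<le> y)"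
  shows "(\<integral>\<^sup>+z. (2 * neg_ln \<bar>fst z - snd z\<bar> + ennreal (4 * ln 2 - 2)) * indicator (A \<times> B) z \<partial>(unif \<Otimes>\<^sub>M unif))
    \<le> ennreal (ln 2) * (of_nat n * emeasure (unif \<Otimes>\<^sub>M unif) (A \<times> B)) + ennreal (1 / 2 ^ n)"
proof -
  let ?Q = "unif \<Otimes>\<^sub>M unif"
  have unit: "\<exists>r. emeasure lborel S = ennreal r \<and> 0 \<le> r \<and> r \<le> 1" if "S \<subseteq> {0..<1}" for S :: "real set"
    using emeasure_mono[OF that, of lborel]
    by (cases "emeasure lborel S") (auto simp: top_unique)
  obtain a where a: "emeasure lborel A = ennreal a" "0 \<le> a" "a \<le> 1"
    using unit[OF A] by blast
  obtain b where b: "emeasure lborel B = ennreal b" "0 \<le> b" "b \<le> 1"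
    using unit[OF B] by blast
  have AB: "emeasure ?Q (A \<times> B) = ennreal (a * b)"
    using a b by (simp add: emeasure_unif_rectangle A B ennreal_mult)
  show ?thesis
  proof (cases "a * b = 0")
    case True
    then have "A \<times> B \<in> null_sets ?Q" using AB by (intro null_setsI) auto
    then show ?thesis by (subst nn_integral_null_set) auto
  next
    case False
    then have pos: "0 < a" "0 < b" "0 < a * b" using a b by (auto simp: less_le)
    define p where "p = a * b"
    have p: "0 < p" "p \<le> 1" "ln p \<le> 0"
      using pos a b by (auto simp: p_def mult_le_one)
    have "2 * (\<integral>\<^sup>+x. (\<integral>\<^sup>+y. neg_ln \<bar>x - y\<bar> * indicator B y \<partial>lborel) * indicator A x \<partial>lborel)
      \<le> 2 * ennreal (neg_ln_int2 (a + b) - neg_ln_int2 a - neg_ln_int2 b)"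
      using A B a b pos mono by (intro mult_left_mono nn_integral_neg_ln_monochromatic) auto
    also have "\<dots> = ennreal (2 * (neg_ln_int2 (a + b) - neg_ln_int2 a - neg_ln_int2 b))"
      by (subst ennreal_mult') auto
    also have "\<dots> \<le> ennreal (p * (3 - 4 * ln 2 - ln p))"
      unfolding p_def using pos by (intro ennreal_leI neg_ln_int2_diff_le)
    finally have *: "2 * (\<integral>\<^sup>+z. neg_ln \<bar>fst z - snd z\<bar> * indicator (A \<times> B) z \<partial>?Q) \<le> ennreal (p * (3 - 4 * ln 2 - ln p))"
      using A B by (subst nn_integral_unif_rectangle) auto
    have "(\<integral>\<^sup>+z. (2 * neg_ln \<bar>fst z - snd z\<bar> + ennreal (4 * ln 2 - 2)) * indicator (A \<times> B) z \<partial>?Q)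
      = (\<integral>\<^sup>+z. 2 * (neg_ln \<bar>fst z - snd z\<bar> * indicator (A \<times> B) z) + ennreal (4 * ln 2 - 2) * indicator (A \<times> B) z \<partial>?Q)"
      by (simp add: distrib_right mult.assoc)
    also have "\<dots> = 2 * (\<integral>\<^sup>+z. neg_ln \<bar>fst z - snd z\<bar> * indicator (A \<times> B) z \<partial>?Q) + ennreal (4 * ln 2 - 2) * ennreal p"
      by (subst nn_integral_add) (auto simp: nn_integral_cmult nn_integral_cmult_indicator AB p_def)
    also have "\<dots> \<le> ennreal (p * (3 - 4 * ln 2 - ln p)) + ennreal (4 * ln 2 - 2) * ennreal p"
      using * by (rule add_right_mono)
    also have "\<dots> = ennreal (p * (3 - 4 * ln 2 - ln p) + (4 * ln 2 - 2) * p)"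
    proof -
      \<comment> \<open>Both summands must be nonnegative to be merged inside
        \<open>ennreal\<close>; the bounds on \<open>ln 2\<close> put \<open>4 * ln 2\<close>
        between \<open>8 / 3\<close> and \<open>25 / 9\<close>.\<close>
      have "0 \<le> 3 - 4 * ln 2 - ln p" "0 \<le> 4 * ln 2 - (2 :: real)"
        using p(3) ln2_ge_two_thirds ln2_le_25_over_36 by linarith+
      then show ?thesis using p by (simp add: ennreal_mult' ennreal_plus)
    qed
    also have "p * (3 - 4 * ln 2 - ln p) + (4 * ln 2 - 2) * p = p * (1 - ln p)"
      by (simp add: algebra_simps)
    also have "p * (1 - ln p) \<le> ln 2 * (real n * p) + 1 / 2 ^ n"
    proof -
      \<comment> \<open>Gibbs' inequality is \<open>ln q <= q - 1\<close> at the ratio of the Kraft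
        weight to the probability, multiplied by \<open>p\<close>.\<close>
      have "ln ((1 / 2 ^ n) / p) \<le> (1 / 2 ^ n) / p - 1"
        using p by (intro ln_le_minus_one) auto
      moreover have "ln ((1 / 2 ^ n) / p) = - (real n * ln 2) - ln p"
        using p by (simp add: ln_div ln_realpow ln_mult)
      ultimately have "p * (1 - ln p) \<le> p * (real n * ln 2 + (1 / 2 ^ n) / p)"
        using p by (intro mult_left_mono) auto
      also have "\<dots> = ln 2 * (real n * p) + 1 / 2 ^ n"
        using p by (simp add: field_simps)
      finally show ?thesis .
    qed
    also have "ennreal (ln 2 * (real n * p) + 1 / 2 ^ n) = ennreal (ln 2) * (of_nat n * emeasure ?Q (A \<times> B)) + ennreal (1 / 2 ^ n)"
      using p by (simp add: AB p_def[symmetric] ennreal_mult ennreal_of_nat_eq_real_of_nat)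
    finally show ?thesis by (simp add: ennreal_leI)
  qed
qed

section \<open>Rectangles and disjointness of the leaves of a protocol\<close>

lemma reaching_eq_rectangle:
  assumes "borel_protocol P" "v \<in> vertices P"
  obtains A B where "A \<in> sets borel" "B \<in> sets borel" "A \<subseteq> {0..<1}" "B \<subseteq> {0..<1}"
    "reaching P v = A \<times> B"
proof -
  \<comment> \<open>From the values of node \<open>i\<close>, those contradicting a bit sent by
    \<open>i\<close> on the way to \<open>v\<close> are removed; at positions owned by the other
    node nothing is removed.\<close>
  define S where "S i = {0..<1} - (\<Union>k<length v. {x \<in> {0..<1}. \<exists>\<phi>. P (take k v) = Internal i \<phi> \<and> v ! k \<noteq> \<phi> x})"
    for i
  have "{x \<in> {0..<1}. \<exists>\<phi>. P (take k v) = Internal i \<phi> \<and> v ! k \<noteq> \<phi> x} \<in> sets borel"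
    if k: "k < length v" for i k
  proof (cases "\<exists>\<phi>. P (take k v) = Internal i \<phi>")
    case True
    then obtain \<phi> where \<phi>: "P (take k v) = Internal i \<phi>" by blast
    \<comment> \<open>Borel labels are guaranteed only inside the tree, so the prefix has to be a
      vertex.\<close>
    have "take k v \<in> vertices P"
      using assms(2) k by (auto simp: vertices_def min_def)
    then have [measurable]: "\<phi> \<in> measurable (restrict_space borel {0..<1}) (count_space UNIV)"
      using assms(1) \<phi> unfolding borel_protocol_def by blast
    have "\<phi> -` {\<not> v ! k} \<inter> space (restrict_space borel {0..<1}) \<in> sets (restrict_space borel {0..<1})"
      by (rule measurable_sets[of \<phi> _ "count_space UNIV"]) auto
    then have "\<phi> -` {\<not> v ! k} \<inter> {0..<1} \<in> sets borel"
      by (auto simp: sets_restrict_space_iff space_restrict_space)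
    also have "\<phi> -` {\<not> v ! k} \<inter> {0..<1} = {x \<in> {0..<1}. \<exists>\<phi>. P (take k v) = Internal i \<phi> \<and> v ! k \<noteq> \<phi> x}"
      using \<phi> by auto
    finally show ?thesis .
  qed auto
  then have "S i \<in> sets borel" for i
    unfolding S_def by (intro sets.Diff sets.finite_UN) auto
  moreover have "S i \<subseteq> {0..<1}" for i by (auto simp: S_def)
  moreover have "reaching P v = S Node1 \<times> S Node2"
  proof -
    \<comment> \<open>A \<open>Leaf\<close> label above \<open>v\<close> would make
      \<open>reaching P v\<close> empty but would not restrict \<open>S\<close>; membership in
      \<open>vertices\<close> excludes it.\<close>
    have internal: "\<exists>i \<phi>. P (take k v) = Internal i \<phi>" if "k < length v" for k
      using assms(2) that by (cases "P (take k v)") (auto simp: vertices_def)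
    have "(\<exists>i \<phi>. P (take k v) = Internal i \<phi> \<and> v ! k = \<phi> (input i (x, y))) \<longleftrightarrow>
        (\<forall>\<phi>. P (take k v) = Internal Node1 \<phi> \<longrightarrow> v ! k = \<phi> x) \<and>
        (\<forall>\<phi>. P (take k v) = Internal Node2 \<phi> \<longrightarrow> v ! k = \<phi> y)" if "k < length v" for k x y
    proof -
      obtain i \<phi> where "P (take k v) = Internal i \<phi>" using internal \<open>k < length v\<close> by blast
      then show ?thesis by (cases i) auto
    qed
    then show ?thesis by (auto simp: reaching_def inputs_def S_def)
  qed
  ultimately show thesis by (intro that[of "S Node1" "S Node2"])
qed

lemma leaves_prefix_free:
  assumes "v \<in> leaves P" "w \<in> leaves P" "take (length v) w = v"
  shows "v = w"
proof (rule ccontr)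
  assume "v \<noteq> w"
  then have "length v < length w"
    using assms(3) by (metis length_take min.cobounded1 not_le_imp_less take_all)
  then have "P (take (length v) w) \<noteq> Leaf"
    using assms(2) by (simp add: leaves_def vertices_def)
  then show False using assms(1,3) by (simp add: leaves_def)
qed

text \<open>The protocol is deterministic: once the transcripts agree on \<open>k\<close> bits, the
  same vertex is asked about the same input, which fixes the next bit.\<close>

lemma take_eq_take_if_reaching:
  assumes "x \<in> reaching P v" "x \<in> reaching P w" "k \<le> length v" "k \<le> length w"
  shows "take k v = take k w"
  using assms(3,4)
proof (induction k)
  case (Suc k)
  then have IH: "take k v = take k w" by simp
  have "v ! k = w ! k"
    using assms(1,2) Suc.prems IH unfolding reaching_def
    by (force dest!: spec[of _ k])
  then show ?case using IH Suc.prems by (simp add: take_Suc_conv_app_nth)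
qed simp

lemma reaching_leaf_unique:
  assumes "v \<in> leaves P" "w \<in> leaves P" "x \<in> reaching P v" "x \<in> reaching P w"
  shows "v = w"
proof (cases "length v \<le> length w")
  case True
  then show ?thesis
    using take_eq_take_if_reaching[OF assms(3,4), of "length v"] leaves_prefix_free[OF assms(1,2)]
    by simp
next
  case False
  then show ?thesis
    using take_eq_take_if_reaching[OF assms(3,4), of "length w"] leaves_prefix_free[OF assms(2,1)]
    by simp
qed

text \<open>Distinct leaves have disjoint rectangles, so a single term survives. This serves both to
  split an integral over the leaves and to read off the depth reached.\<close>

lemma nn_integral_leaves_indicator:
  assumes "w \<in> leaves P" "x \<in> reaching P w"
  shows "(\<integral>\<^sup>+v. c v * indicator (reaching P v) x \<partial>count_space (leaves P)) = c w"
  using assms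
  by (subst nn_integral_count_space'[of "{w}"]) (auto simp: indicator_def dest: reaching_leaf_unique)

section \<open>Kraft's inequality for prefix-free sets of bit lists\<close>

text \<open>Each \<open>v\<close> has \<open>2 ^ (n - length v)\<close> extensions of length
  \<open>n\<close>. Two prefixes of one word are comparable, so prefix-freeness makes these families
  disjoint among the \<open>2 ^ n\<close> words.\<close>

lemma Kraft_inequality_finite:
  fixes S :: "bool list set"
  assumes prefix_free: "\<And>v w. v \<in> S \<Longrightarrow> w \<in> S \<Longrightarrow> take (length v) w = v \<Longrightarrow> v = w"
    and n: "\<And>v. v \<in> S \<Longrightarrow> length v \<le> n"
  shows "(\<Sum>v\<in>S. 1 / 2 ^ length v) \<le> (1 :: real)"
proof -
  have fin: "finite {w :: bool list. length w = m}" and card: "card {w :: bool list. length w = m} = 2 ^ m" for m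
    using finite_lists_length_eq[of "UNIV :: bool set" m] card_lists_length_eq[of "UNIV :: bool set" m] by auto
  have "finite S"
    using n by (intro finite_subset[OF _ finite_lists_length_le[of "UNIV :: bool set" n]]) auto
  let ?E = "\<lambda>v. (@) v ` {w :: bool list. length w = n - length v}"
  have card_E: "card (?E v) = 2 ^ (n - length v)" for v
    by (subst card_image) (auto simp: card inj_on_def)
  have "?E v \<inter> ?E w = {}" if "v \<in> S" "w \<in> S" "v \<noteq> w" for v w
  proof (rule ccontr)
    assume "?E v \<inter> ?E w \<noteq> {}"
    then obtain s t where "v @ s = w @ t" by auto
    then have "take (length v) w = v \<or> take (length w) v = w"
      by (auto simp: append_eq_append_conv2)
    then show False using prefix_free that by metis
  qed
  then have "(\<Sum>v\<in>S. card (?E v)) = card (\<Union>v\<in>S. ?E v)"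
    using \<open>finite S\<close> fin by (subst card_UN_disjoint) auto
  also have "\<dots> \<le> card {w :: bool list. length w = n}"
    using n by (intro card_mono fin) auto
  finally have "(\<Sum>v\<in>S. 2 ^ (n - length v)) \<le> (2 ^ n :: nat)"
    by (simp add: card_E card)
  then have "(\<Sum>v\<in>S. 2 ^ (n - length v)) \<le> (2 ^ n :: real)"
    by (metis (mono_tags, lifting) of_nat_le_iff of_nat_numeral of_nat_power of_nat_sum sum.cong)
  moreover have "(\<Sum>v\<in>S. 2 ^ (n - length v)) = 2 ^ n * (\<Sum>v\<in>S. 1 / 2 ^ length v :: real)"
    using n by (simp add: sum_distrib_left power_diff)
  ultimately show ?thesis by simp
qed

text \<open>An infinite tree may have infinitely many leaves; truncating at length \<open>n\<close>
  and monotone convergence reduce to the finite case.\<close>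

lemma Kraft_inequality:
  fixes S :: "bool list set"
  assumes prefix_free: "\<And>v w. v \<in> S \<Longrightarrow> w \<in> S \<Longrightarrow> take (length v) w = v \<Longrightarrow> v = w"
  shows "(\<integral>\<^sup>+v. ennreal (1 / 2 ^ length v) \<partial>count_space S) \<le> 1"
proof -
  let ?f = "\<lambda>n v. ennreal (1 / 2 ^ length v) * indicator {v. length v \<le> n} v"
  have "(\<integral>\<^sup>+v. ennreal (1 / 2 ^ length v) \<partial>count_space S) = (\<integral>\<^sup>+v. (SUP n. ?f n v) \<partial>count_space S)"
  proof (rule nn_integral_cong)
    fix v :: "bool list"
    show "ennreal (1 / 2 ^ length v) = (SUP n. ?f n v)"
      by (intro antisym SUP_upper2[of "length v"] SUP_least) (auto simp: indicator_def)
  qed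
  also have "\<dots> = (SUP n. \<integral>\<^sup>+v. ?f n v \<partial>count_space S)"
    by (intro nn_integral_monotone_convergence_SUP incseq_SucI le_funI)
      (auto simp: indicator_def)
  also have "\<dots> \<le> 1"
  proof (rule SUP_least)
    fix n
    let ?S = "{v \<in> S. length v \<le> n}"
    have "finite ?S"
      using finite_lists_length_le[of "UNIV :: bool set" n] by (auto intro: finite_subset)
    then have "(\<integral>\<^sup>+v. ?f n v \<partial>count_space S) = (\<Sum>v\<in>?S. ?f n v)"
      by (intro nn_integral_count_space') auto
    also have "\<dots> = (\<Sum>v\<in>?S. ennreal (1 / 2 ^ length v))"
      by (intro sum.cong) auto
    also have "\<dots> = ennreal (\<Sum>v\<in>?S. 1 / 2 ^ length v)"
      by (rule sum_ennreal) simp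
    also have "\<dots> \<le> ennreal 1"
      using prefix_free by (intro ennreal_leI Kraft_inequality_finite[of _ n]) auto
    finally show "(\<integral>\<^sup>+v. ?f n v \<partial>count_space S) \<le> 1" by simp
  qed
  finally show ?thesis .
qed

section \<open>Summation over the leaves\<close>

lemma leaf_bound:
  assumes "borel_protocol P" "zero_error threshold P" "v \<in> leaves P"
  shows "(\<integral>\<^sup>+z. (2 * neg_ln \<bar>fst z - snd z\<bar> + ennreal (4 * ln 2 - 2)) * indicator (reaching P v) z \<partial>(unif \<Otimes>\<^sub>M unif))
    \<le> ennreal (ln 2) * (of_nat (length v) * emeasure (unif \<Otimes>\<^sub>M unif) (reaching P v)) + ennreal (1 / 2 ^ length v)"
proof -
  have "v \<in> vertices P" using assms(3) by (simp add: leaves_def)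
  with assms(1) obtain A B where AB: "A \<in> sets borel" "B \<in> sets borel"
    "A \<subseteq> {0..<1}" "B \<subseteq> {0..<1}" "reaching P v = A \<times> B"
    by (rule reaching_eq_rectangle)
  from assms(2,3) obtain c where c: "\<forall>z\<in>A \<times> B. threshold z = c"
    unfolding zero_error_def constant_on_def AB(5)[symmetric] by blast
  \<comment> \<open>A constant threshold value on the rectangle puts it on one side of the
    diagonal.\<close>
  have ord: "if c = 1 then y \<le> x else x \<le> y" if "x \<in> A" "y \<in> B" for x y
  proof -
    have "threshold (x, y) = c" using c that by blast
    then show ?thesis by (cases "y \<le> x") (simp_all add: threshold_def)
  qed
  have "(\<forall>x\<in>A. \<forall>y\<in>B. y \<le> x) \<or> (\<forall>x\<in>A. \<forall>y\<in>B. x \<le> y)"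
    using ord by (cases "c = 1") simp_all
  then show ?thesis
    unfolding AB(5) using AB(1-4) by (intro monochromatic_rectangle_bound)
qed

theorem theorem4:
  fixes M :: "'a measure" and X1 X2 :: "'a \<Rightarrow> real" and P :: protocol
  assumes "prob_space M"
    and "prob_space.indep_var M borel X1 borel X2"
    and "distr M borel X1 = uniform_measure lborel {0..<1}"
    and "distr M borel X2 = uniform_measure lborel {0..<1}"
    and "borel_protocol P"
    and "AE \<omega> in M. terminates_on P (X1 \<omega>, X2 \<omega>)"
    and "zero_error threshold P"
  shows "sum_rate M X1 X2 P \<ge> 4"
proof -
  interpret prob_space M by fact
  interpret U: prob_space unif by (rule prob_space_unif)
  interpret UU: pair_prob_space unif unif ..
  let ?Q = "unif \<Otimes>\<^sub>M unif"
  let ?L = "count_space (leaves P)"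
  define Z where "Z \<omega> = (X1 \<omega>, X2 \<omega>)" for \<omega>
  define h where "h z = 2 * neg_ln \<bar>fst z - snd z\<bar> + ennreal (4 * ln 2 - 2)" for z :: "real \<times> real"
  \<comment> \<open>Independence enters here: the joint law of the inputs is the product of the two
    uniform laws.\<close>
  have [measurable]: "Z \<in> M \<rightarrow>\<^sub>M borel \<Otimes>\<^sub>M borel" and distr_Z: "distr M (borel \<Otimes>\<^sub>M borel) Z = ?Q"
    using assms(2-4) unfolding indep_var_distribution_eq Z_def by auto
  have [measurable]: "h \<in> borel_measurable (borel \<Otimes>\<^sub>M borel)" unfolding h_def by measurable
  have E: "(\<integral>\<^sup>+\<omega>. g (Z \<omega>) \<partial>M) = (\<integral>\<^sup>+z. g z \<partial>?Q)" if "g \<in> borel_measurable (borel \<Otimes>\<^sub>M borel)"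
    for g :: "real \<times> real \<Rightarrow> ennreal"
    unfolding distr_Z[symmetric] using that by (subst nn_integral_distr) auto
  have R[measurable]: "reaching P v \<in> sets (borel \<Otimes>\<^sub>M borel)" if "v \<in> leaves P" for v
  proof -
    have "v \<in> vertices P" using that by (simp add: leaves_def)
    with assms(5) show ?thesis by (rule reaching_eq_rectangle) auto
  qed
  have "ennreal (1 + 4 * ln 2) = 2 * ennreal (3 / 2) + ennreal (4 * ln 2 - 2)"
  proof -
    have "2 * ennreal (3 / 2) = ennreal 3"
      by (simp add: ennreal_mult'[of 2 "3/2", simplified, symmetric])
    moreover have "ennreal 3 + ennreal (4 * ln 2 - 2) = ennreal (3 + (4 * ln 2 - 2))"
      using ln2_ge_two_thirds by (intro ennreal_plus[symmetric]) auto
    ultimately show ?thesis by simp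
  qed
  also have "\<dots> = (\<integral>\<^sup>+z. h z \<partial>?Q)"
    unfolding h_def
    by (subst nn_integral_add) (auto simp: nn_integral_cmult nn_integral_neg_ln_unif UU.emeasure_space_1)
  also have "\<dots> = (\<integral>\<^sup>+\<omega>. h (Z \<omega>) \<partial>M)" by (rule E[symmetric]) simp
  \<comment> \<open>Almost surely exactly one leaf is reached, so the indicators of the leaves sum
    to one.\<close>
  also have "\<dots> = (\<integral>\<^sup>+\<omega>. (\<integral>\<^sup>+v. h (Z \<omega>) * indicator (reaching P v) (Z \<omega>) \<partial>?L) \<partial>M)"
    using assms(6)
    by (intro nn_integral_cong_AE)
      (auto simp: terminates_on_def Z_def nn_integral_leaves_indicator elim!: eventually_mono)
  \<comment> \<open>Sum and integral may be exchanged since there are only countably many bit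
    lists.\<close>
  also have "\<dots> = (\<integral>\<^sup>+v. (\<integral>\<^sup>+\<omega>. h (Z \<omega>) * indicator (reaching P v) (Z \<omega>) \<partial>M) \<partial>?L)"
    by (rule nn_integral_count_space_nn_integral) auto
  also have "\<dots> = (\<integral>\<^sup>+v. (\<integral>\<^sup>+z. h z * indicator (reaching P v) z \<partial>?Q) \<partial>?L)"
    by (intro nn_integral_cong E) auto
  also have "\<dots> \<le> (\<integral>\<^sup>+v. ennreal (ln 2) * (of_nat (length v) * emeasure ?Q (reaching P v))
      + ennreal (1 / 2 ^ length v) \<partial>?L)"
    unfolding h_def using assms(5,7) by (intro nn_integral_mono leaf_bound) auto
  also have "\<dots> = ennreal (ln 2) * (\<integral>\<^sup>+v. of_nat (length v) * emeasure ?Q (reaching P v) \<partial>?L)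
      + (\<integral>\<^sup>+v. ennreal (1 / 2 ^ length v) \<partial>?L)"
    by (subst nn_integral_add) (auto simp: nn_integral_cmult)
  also have "\<dots> \<le> ennreal (ln 2) * sum_rate M X1 X2 P + 1"
  proof (intro add_mono mult_left_mono)
    show "(\<integral>\<^sup>+v. ennreal (1 / 2 ^ length v) \<partial>?L) \<le> 1"
      by (rule Kraft_inequality) (rule leaves_prefix_free)
    have "(\<integral>\<^sup>+v. of_nat (length v) * emeasure ?Q (reaching P v) \<partial>?L)
        = (\<integral>\<^sup>+v. (\<integral>\<^sup>+z. of_nat (length v) * indicator (reaching P v) z \<partial>?Q) \<partial>?L)"
      by (intro nn_integral_cong nn_integral_cmult_indicator[symmetric]) auto
    also have "\<dots> = (\<integral>\<^sup>+v. (\<integral>\<^sup>+\<omega>. of_nat (length v) * indicator (reaching P v) (Z \<omega>) \<partial>M) \<partial>?L)"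
      by (intro nn_integral_cong E[symmetric]) auto
    also have "\<dots> = (\<integral>\<^sup>+\<omega>. (\<integral>\<^sup>+v. of_nat (length v) * indicator (reaching P v) (Z \<omega>) \<partial>?L) \<partial>M)"
      by (rule nn_integral_count_space_nn_integral[symmetric]) auto
    also have "\<dots> \<le> sum_rate M X1 X2 P"
      unfolding sum_rate_def
    proof (rule nn_integral_mono_AE)
      show "AE \<omega> in M. (\<integral>\<^sup>+v. of_nat (length v) * indicator (reaching P v) (Z \<omega>) \<partial>?L) \<le> num_bits P (X1 \<omega>, X2 \<omega>)"
        using assms(6)
      proof eventually_elim
        fix \<omega> assume "terminates_on P (X1 \<omega>, X2 \<omega>)"
        then obtain w where w: "w \<in> leaves P" "Z \<omega> \<in> reaching P w"
          by (auto simp: terminates_on_def Z_def)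
        \<comment> \<open>The leaf reached is itself one of the visited vertices in the
          supremum.\<close>
        then have "of_nat (length w) \<le> num_bits P (Z \<omega>)"
          unfolding num_bits_def by (intro SUP_upper) (simp add: leaves_def)
        then show "(\<integral>\<^sup>+v. of_nat (length v) * indicator (reaching P v) (Z \<omega>) \<partial>?L) \<le> num_bits P (X1 \<omega>, X2 \<omega>)"
          using nn_integral_leaves_indicator[OF w] by (simp add: Z_def)
      qed
    qed
    finally show "(\<integral>\<^sup>+v. of_nat (length v) * emeasure ?Q (reaching P v) \<partial>?L) \<le> sum_rate M X1 X2 P" .
  qed simp
  finally have *: "ennreal (1 + 4 * ln 2) \<le> ennreal (ln 2) * sum_rate M X1 X2 P + 1" .
  show ?thesis
  \<comment> \<open>For a finite rate, cancelling \<open>1\<close> and dividing by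
    \<open>ln 2\<close> leaves \<open>4\<close>.\<close>
  proof (cases "sum_rate M X1 X2 P")
    case (real r)
    then have "ennreal (1 + 4 * ln 2) \<le> ennreal (ln 2 * r + 1)"
      using * by (simp add: ennreal_mult ennreal_plus)
    then have "1 + 4 * ln 2 \<le> ln 2 * r + 1"
      using real by (subst (asm) ennreal_le_iff) auto
    then have "4 \<le> r" by simp
    then show ?thesis using real by (simp add: ennreal_leI flip: ennreal_numeral)
  qed simp
qed

end
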